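(* Let $m\ge 3$ be an even number with unique prime factorization (up to ordering) $m=2^{\alpha}p_1^{\alpha_1}p_2^{\alpha_2}\cdots p_k^{\alpha_k}$, where $p_1,\dots,p_k$ are distinct odd primes, and let $n$ be a positive integer. Then $G=C_m\odot\overline{K}_n$ admits at least $\left(\sum_{i=1}^k\alpha_i\right)(n+1)$ mutually different magic sums. If $\alpha\ge 2$, this lower bound can be improved to $\left(1+\sum_{i=1}^k\alpha_i\right)(n+1)$, that is, $G$ admits at least $\left(1+\sum_{i=1}^k\alpha_i\right)(n+1)$ mutually different magic sums.
   Context: For graphs $G,H$, the corona product $G\odot H$ is obtained from one copy of $G$ and $|V(G)|$ copies of $H$ by joining each vertex of $G$ to all vertices of one copy of $H$, in such a way that all vertices in the same copy of $H$ are joined to exactly one vertex of $G$. $C_m$ is the cycle of order $m$ and $\overline{K}_n$ is the graph with $n$ vertices and no edges; so $C_m\odot\overline{K}_n$ is the cycle $C_m$ with $n$ pendant vertices attached to each cycle vertex. Let $G=(V,E)$ be a graph with $P=|V|$ vertices and $Q=|E|$ edges. An edge-magic labeling of $G$ is a bijection $f:V\cup E\to\{1,\dots,P+Q\}$ such that $f(x)+f(xy)+f(y)=s$ for every edge $xy\in E$, where $s$ is a constant called the valence or magic sum of $f$. "$G$ admits at least $N$ mutually different magic sums" means that at least $N$ distinct integers occur as magic sums of edge-magic labelings of $G$. *)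

theory Defs
  imports Complex_Main "HOL-Computational_Algebra.Primes"
begin

text \<open>
  Simple undirected graphs, with edges represented as two-element sets of vertices.
  (The digraph library models an undirected edge as a pair of opposite arcs, which would be
  two separate objects to label.)
\<close>

record 'a ugraph =
  verts :: "'a set"
  edges :: "'a set set"

definition simple_graph :: "'a ugraph \<Rightarrow> bool" where
  "simple_graph G \<longleftrightarrow> finite (verts G) \<and> (\<forall>e\<in>edges G. e \<subseteq> verts G \<and> card e = 2)"

text \<open>This is the cycle of order \<open>m\<close> only for \<open>m \<ge> 3\<close>.\<close>

definition cycle_graph :: "nat \<Rightarrow> nat ugraph" where
  "cycle_graph m = \<lparr>verts = {..<m}, edges = {{i, Suc i mod m} | i. i < m}\<rparr>"

definition edgeless_graph :: "nat \<Rightarrow> nat ugraph" where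
  "edgeless_graph n = \<lparr>verts = {..<n}, edges = {}\<rparr>"

text \<open>
  \<open>Inl v\<close> is the vertex \<open>v\<close> of \<open>G\<close>, and \<open>Inr (v, w)\<close> is the vertex \<open>w\<close> in the copy
  of \<open>H\<close> that belongs to \<open>v\<close>.
\<close>

definition corona :: "'a ugraph \<Rightarrow> 'b ugraph \<Rightarrow> ('a + 'a \<times> 'b) ugraph" where
  "corona G H =
    \<lparr>verts = Inl ` verts G \<union> Inr ` (verts G \<times> verts H),
     edges = {Inl ` e | e. e \<in> edges G}
           \<union> {(\<lambda>w. Inr (v, w)) ` e | v e. v \<in> verts G \<and> e \<in> edges H}
           \<union> {{Inl v, Inr (v, w)} | v w. v \<in> verts G \<and> w \<in> verts H}\<rparr>"

text \<open>The disjoint union \<open>V \<union> E\<close> of the mathematical definition is the sum set \<open>V <+> E\<close>.\<close>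

definition edge_magic_labeling :: "'a ugraph \<Rightarrow> ('a + 'a set \<Rightarrow> nat) \<Rightarrow> nat \<Rightarrow> bool" where
  "edge_magic_labeling G f s \<longleftrightarrow>
     bij_betw f (verts G <+> edges G) {1..card (verts G) + card (edges G)} \<and>
     (\<forall>x y. {x, y} \<in> edges G \<longrightarrow> f (Inl x) + f (Inr {x, y}) + f (Inl y) = s)"

definition magic_sums :: "'a ugraph \<Rightarrow> nat set" where
  "magic_sums G = {s. \<exists>f. edge_magic_labeling G f s}"

lemma simple_graph_cycle_graph:
  assumes "m \<ge> 3"
  shows "simple_graph (cycle_graph m)"
proof -
  have "i \<noteq> Suc i mod m" if "i < m" for i
    using assms that by (cases "Suc i = m") auto
  then have "card {i, Suc i mod m} = 2" if "i < m" for i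
    using that by simp
  moreover have "Suc i mod m < m" for i
    using assms by simp
  ultimately show ?thesis
    by (auto simp only: simple_graph_def cycle_graph_def ugraph.simps finite_lessThan
        mem_Collect_eq lessThan_iff insert_subset empty_subsetI)
qed

lemma simple_graph_edgeless_graph: "simple_graph (edgeless_graph n)"
  by (simp add: simple_graph_def edgeless_graph_def)

lemma simple_graph_corona:
  assumes "simple_graph G" "simple_graph H"
  shows "simple_graph (corona G H)"
proof -
  have fin: "finite (verts G)" "finite (verts H)"
    using assms by (auto simp: simple_graph_def)
  have "d \<subseteq> verts (corona G H) \<and> card d = 2" if "d \<in> edges (corona G H)" for d
  proof -
    from that consider
        (G) e where "d = Inl ` e" "e \<in> edges G"
      | (H) v e where "d = (\<lambda>w. Inr (v, w)) ` e" "v \<in> verts G" "e \<in> edges H"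
      | (join) v w where "d = {Inl v, Inr (v, w)}" "v \<in> verts G" "w \<in> verts H"
      unfolding corona_def by auto
    then show ?thesis
    proof cases
      case G
      then show ?thesis
        using assms(1) by (auto simp: simple_graph_def corona_def card_image)
    next
      case H
      have "card d = card e"
        unfolding H(1) by (rule card_image) (simp add: inj_on_def)
      then show ?thesis
        using H assms(2) by (auto simp: simple_graph_def corona_def)
    next
      case join
      then show ?thesis by (simp add: corona_def)
    qed
  qed
  moreover have "finite (verts (corona G H))"
    using fin by (simp add: corona_def)
  ultimately show ?thesis by (simp add: simple_graph_def)
qed

text \<open>
  Every edge makes the magic sums bounded, so \<open>card\<close> really counts the magic sums.
\<close>

lemma finite_magic_sums:
  assumes "simple_graph G" "edges G \<noteq> {}"
  shows "finite (magic_sums G)"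
proof -
  obtain e where e: "e \<in> edges G" using assms(2) by blast
  then have "e \<subseteq> verts G" "card e = 2"
    using assms(1) by (auto simp: simple_graph_def)
  then obtain x y where xy: "e = {x, y}" "x \<in> verts G" "y \<in> verts G"
    by (auto simp: card_2_iff)
  let ?N = "card (verts G) + card (edges G)"
  have "s \<le> ?N + ?N + ?N" if "edge_magic_labeling G f s" for f s
  proof -
    have "f z \<le> ?N" if "z \<in> verts G <+> edges G" for z
    proof -
      have "f ` (verts G <+> edges G) = {1..?N}"
        using \<open>edge_magic_labeling G f s\<close>
        unfolding edge_magic_labeling_def bij_betw_def by blast
      then have "f z \<in> {1..?N}" using that by blast
      then show ?thesis by simp
    qed
    moreover have "f (Inl x) + f (Inr {x, y}) + f (Inl y) = s"
      using that e xy unfolding edge_magic_labeling_def by blast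
    moreover have "Inl x \<in> verts G <+> edges G" "Inr {x, y} \<in> verts G <+> edges G"
        "Inl y \<in> verts G <+> edges G"
      using e xy by auto
    ultimately show ?thesis
      by (metis add_mono)
  qed
  then have "magic_sums G \<subseteq> {..?N + ?N + ?N}"
    by (auto simp: magic_sums_def)
  then show ?thesis
    using finite_subset by blast
qed

end

theory Submission
  imports Defs "HOL-Number_Theory.Cong"
begin

text \<open>
  The labelings are built from smaller ones by a base-\<open>p\<close> expansion. Suppose that \<open>G\<close> maps onto a
  (multi)graph \<open>G\<^sub>0\<close> by a \<open>p\<close>-to-one map of vertices and edges that respects incidence, and that
  every vertex and edge of \<open>G\<close> carries a digit below \<open>p\<close> such that each fibre exhausts the digits
  and the three digits along an edge always add up to the same number \<open>C\<close>. If \<open>f\<close> is an edge-magic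
  labeling of \<open>G\<^sub>0\<close> with valence \<open>s\<close>, then \<open>p * (f - 1) + digit + 1\<close> is one of \<open>G\<close>, with valence
  \<open>p * (s - 3) + C + 3\<close>. This is \<open>magic_on_lift\<close>; the \<open>\<otimes>\<^sub>h\<close>-product of labeled digraphs is of this form.

  The lift is used twice. First, the corona \<open>C\<^sub>m \<odot> K\<^sub>n\<close> (with \<open>K\<^sub>n\<close> edgeless) lies over \<open>C\<^sub>m\<close> with
  \<open>p = n + 1\<close>: the pendant vertices at \<open>v\<close> are sent to the successor of \<open>v\<close>. All cycle vertices
  carry one digit \<open>r \<le> n\<close> of our choice, and the choice is visible in the valence
  \<open>(n + 1) * (s - 3) + r + n + 3\<close>. Reading this number modulo \<open>n + 1\<close> recovers \<open>r\<close>, so each valence of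
  the cycle \<open>C\<^sub>m\<close> yields \<open>n + 1\<close> valences of the corona (\<open>magic_sums_corona_if_cycle_magic\<close>).

  Second, for odd \<open>p\<close> and even \<open>d\<close> the cycle of order \<open>d * p\<close> lies over \<open>C\<^sub>d\<close>; with \<open>C = 3 * (p - 1) / 2\<close>
  this turns the valence \<open>s\<close> into \<open>p * (s - 3) + 3 * (p + 1) / 2\<close> (\<open>cycle_magic_mult_odd\<close>). Every even
  cycle \<open>C\<^sub>d\<close> with \<open>d \<ge> 4\<close> has the valence \<open>5 * d / 2 + 2\<close> (\<open>cycle_magic_even\<close>), and from
  \<open>d = m / p\<close> one gets the valence \<open>5 * m / 2 + (p + 3) / 2\<close> of \<open>C\<^sub>m\<close>, which depends
  injectively on \<open>p\<close>.

  Hence the corona has at least \<open>n + 1\<close> valences for each odd divisor \<open>p\<close> of \<open>m\<close> with \<open>m / p \<ge> 4\<close>.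
  A number with \<open>l\<close> prime factors counted with multiplicity has at least \<open>l + 1\<close> divisors. If
  \<open>4\<close> divides \<open>m\<close>, all odd divisors qualify; otherwise only the largest one is lost, for which
  \<open>m / p = 2\<close>.
\<close>

section \<open>Edge-magic labelings of multigraphs\<close>

text \<open>
  The edges are an index set \<open>J\<close> with end point maps \<open>a\<close> and \<open>b\<close>, because labels of edges are easier
  to describe through an index and an orientation than through a two-element set.
\<close>

definition magic_on ::
  "'v set \<Rightarrow> 'j set \<Rightarrow> ('j \<Rightarrow> 'v) \<Rightarrow> ('j \<Rightarrow> 'v) \<Rightarrow> ('v + 'j \<Rightarrow> nat) \<Rightarrow> nat \<Rightarrow> bool" where
  "magic_on V J a b L s \<longleftrightarrow>
     bij_betw L (V <+> J) {1..card V + card J} \<and>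
     (\<forall>j\<in>J. L (Inl (a j)) + L (Inr j) + L (Inl (b j)) = s)"

lemma bij_betw_map_sum:
  assumes "bij_betw f A A'" and "bij_betw g B B'"
  shows "bij_betw (map_sum f g) (A <+> B) (A' <+> B')"
proof (rule bij_betw_imageI)
  show "inj_on (map_sum f g) (A <+> B)"
    using inj_on_eq_iff[OF bij_betw_imp_inj_on[OF assms(1)]]
      inj_on_eq_iff[OF bij_betw_imp_inj_on[OF assms(2)]]
    by (intro inj_onI) (elim PlusE, simp_all)
  have "map_sum f g ` (A <+> B) = f ` A <+> g ` B"
    by (simp add: Plus_def image_Un image_image)
  then show "map_sum f g ` (A <+> B) = A' <+> B'"
    using assms by (simp add: bij_betw_def)
qed

lemma magic_sums_if_magic_on:
  assumes magic: "magic_on (verts G) J a b L s"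
    and edges: "bij_betw (\<lambda>j. {a j, b j}) J (edges G)"
  shows "s \<in> magic_sums G"
proof -
  define g where "g = the_inv_into J (\<lambda>j. {a j, b j})"
  have g: "bij_betw g (edges G) J"
    unfolding g_def by (rule bij_betw_the_inv_into[OF edges])
  have g_eq: "g {a j, b j} = j" if "j \<in> J" for j
    unfolding g_def using that edges
    by (simp add: bij_betw_def the_inv_into_f_f[of "\<lambda>j. {a j, b j}" J])
  have "bij_betw (map_sum id g) (verts G <+> edges G) (verts G <+> J)"
    using g by (intro bij_betw_map_sum) auto
  moreover have "bij_betw L (verts G <+> J) {1..card (verts G) + card (edges G)}"
    using magic bij_betw_same_card[OF g] by (simp add: magic_on_def)
  ultimately have "bij_betw (L \<circ> map_sum id g) (verts G <+> edges G)
      {1..card (verts G) + card (edges G)}"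
    by (rule bij_betw_trans)
  moreover have "(L \<circ> map_sum id g) (Inl x) + (L \<circ> map_sum id g) (Inr {x, y})
      + (L \<circ> map_sum id g) (Inl y) = s" if xy: "{x, y} \<in> edges G" for x y
  proof -
    obtain j where j: "j \<in> J" "{x, y} = {a j, b j}"
      using xy edges unfolding bij_betw_def by auto
    then have "L (Inl (a j)) + L (Inr j) + L (Inl (b j)) = s"
      using magic by (simp add: magic_on_def)
    moreover have "g {x, y} = j"
      using j g_eq by simp
    moreover have "x = a j \<and> y = b j \<or> x = b j \<and> y = a j"
      using j(2) by (simp add: doubleton_eq_iff)
    ultimately show ?thesis
      by auto
  qed
  ultimately show ?thesis
    unfolding magic_sums_def edge_magic_labeling_def by blast
qed

section \<open>Lifting along a covering with digits\<close>

lemma bij_betw_digits: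
  "bij_betw (\<lambda>(y, c). p * (y - 1) + c + 1) ({1..N} \<times> {..<p}) {1..p * N :: nat}"
proof (rule bij_betw_byWitness[where f' = "\<lambda>z. ((z - 1) div p + 1, (z - 1) mod p)"])
  have "p * (y - 1) + c + 1 \<le> p * N" if "1 \<le> y" "y \<le> N" "c < p" for y c
  proof -
    have "p * (y - 1) + c + 1 \<le> p * (y - 1) + p" using that by simp
    also have "\<dots> = p * y" using that by (cases y) auto
    also have "\<dots> \<le> p * N" using that by simp
    finally show ?thesis .
  qed
  then show "(\<lambda>(y, c). p * (y - 1) + c + 1) ` ({1..N} \<times> {..<p}) \<subseteq> {1..p * N}"
    by fastforce
  have "(z - 1) div p + 1 \<le> N" "(z - 1) mod p < p" if "1 \<le> z" "z \<le> p * N" for z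
  proof -
    have "z - 1 < N * p" using that by (simp add: mult.commute)
    then show "(z - 1) div p + 1 \<le> N"
      using less_mult_imp_div_less by fastforce
    show "(z - 1) mod p < p" using that by (cases p) auto
  qed
  then show "(\<lambda>z. ((z - 1) div p + 1, (z - 1) mod p)) ` {1..p * N} \<subseteq> {1..N} \<times> {..<p}"
    by fastforce
qed auto

text \<open>
  The labels of the base are the leading part and the digits \<open>c\<close> and \<open>t\<close> the last digit of the new
  labels (all shifted by one, since labels start at \<open>1\<close>). Each of the two parts is constant along
  edges by itself: the leading parts add up to \<open>s - 3\<close>, the digits to \<open>C\<close>.
\<close>

lemma magic_on_lift:
  assumes magic: "magic_on V0 J0 a0 b0 L0 s"
    and V: "bij_betw (\<lambda>x. (\<pi> x, c x)) V (V0 \<times> {..<p})"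
    and J: "bij_betw (\<lambda>j. (\<rho> j, t j)) J (J0 \<times> {..<p})"
    and ends: "\<And>j. j \<in> J \<Longrightarrow> \<pi> (a j) = a0 (\<rho> j) \<and> \<pi> (b j) = b0 (\<rho> j)"
    and ends_in: "\<And>j. j \<in> J0 \<Longrightarrow> a0 j \<in> V0 \<and> b0 j \<in> V0"
    and digits: "\<And>j. j \<in> J \<Longrightarrow> c (a j) + t j + c (b j) = C"
  shows "\<exists>L. magic_on V J a b L (p * (s - 3) + C + 3)"
proof -
  let ?N = "card V0 + card J0"
  define \<phi> where "\<phi> = map_sum \<pi> \<rho>"
  define d where "d = case_sum c t"
  define L where "L z = p * (L0 (\<phi> z) - 1) + d z + 1" for z
  have L0: "bij_betw L0 (V0 <+> J0) {1..?N}"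
    using magic by (simp add: magic_on_def)
  have lifted: "bij_betw (\<lambda>z. (\<phi> z, d z)) (V <+> J) ((V0 <+> J0) \<times> {..<p})"
  proof (rule bij_betw_imageI)
    show "inj_on (\<lambda>z. (\<phi> z, d z)) (V <+> J)"
    proof (rule inj_onI)
      fix z z' assume "z \<in> V <+> J" "z' \<in> V <+> J" "(\<phi> z, d z) = (\<phi> z', d z')"
      then show "z = z'"
        using inj_onD[OF bij_betw_imp_inj_on[OF V]] inj_onD[OF bij_betw_imp_inj_on[OF J]]
        by (cases z; cases z') (auto simp: \<phi>_def d_def)
    qed
    have V_im: "(\<lambda>x. (\<pi> x, c x)) ` V = V0 \<times> {..<p}"
      and J_im: "(\<lambda>j. (\<rho> j, t j)) ` J = J0 \<times> {..<p}"
      using V J by (simp_all add: bij_betw_def)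
    show "(\<lambda>z. (\<phi> z, d z)) ` (V <+> J) = (V0 <+> J0) \<times> {..<p}"
    proof (intro equalityI subsetI)
      fix w assume "w \<in> (\<lambda>z. (\<phi> z, d z)) ` (V <+> J)"
      then obtain z where "z \<in> V <+> J" "w = (\<phi> z, d z)" by blast
      then show "w \<in> (V0 <+> J0) \<times> {..<p}"
        using V_im J_im by (cases z) (auto simp: \<phi>_def d_def)
    next
      fix w assume w: "w \<in> (V0 <+> J0) \<times> {..<p}"
      show "w \<in> (\<lambda>z. (\<phi> z, d z)) ` (V <+> J)"
      proof (cases "fst w")
        case (Inl x)
        then have "(x, snd w) \<in> (\<lambda>x. (\<pi> x, c x)) ` V"
          using w unfolding V_im by auto
        then obtain v where "v \<in> V" "\<pi> v = x" "c v = snd w" by auto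
        then show ?thesis
          using Inl by (intro image_eqI[of _ _ "Inl v"]) (auto simp: \<phi>_def d_def prod_eq_iff)
      next
        case (Inr x)
        then have "(x, snd w) \<in> (\<lambda>j. (\<rho> j, t j)) ` J"
          using w unfolding J_im by auto
        then obtain j where "j \<in> J" "\<rho> j = x" "t j = snd w" by auto
        then show ?thesis
          using Inr by (intro image_eqI[of _ _ "Inr j"]) (auto simp: \<phi>_def d_def prod_eq_iff)
      qed
    qed
  qed
  have base: "bij_betw (map_prod L0 id) ((V0 <+> J0) \<times> {..<p}) ({1..?N} \<times> {..<p})"
    using L0 by (intro bij_betw_map_prod) auto
  have "L = (\<lambda>(y, c). p * (y - 1) + c + 1) \<circ> (map_prod L0 id \<circ> (\<lambda>z. (\<phi> z, d z)))"
    by (simp add: fun_eq_iff L_def)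
  then have bij: "bij_betw L (V <+> J) {1..p * ?N}"
    using bij_betw_trans[OF bij_betw_trans[OF lifted base] bij_betw_digits] by simp
  have "card V = p * card V0" "card J = p * card J0"
    using bij_betw_same_card[OF V] bij_betw_same_card[OF J]
    by (simp_all add: card_cartesian_product mult.commute)
  then have "bij_betw L (V <+> J) {1..card V + card J}"
    using bij by (simp add: algebra_simps)
  moreover have "L (Inl (a j)) + L (Inr j) + L (Inl (b j)) = p * (s - 3) + C + 3"
    if j: "j \<in> J" for j
  proof -
    have r: "\<rho> j \<in> J0" using J j by (auto simp: bij_betw_def)
    define A B E where "A = L0 (Inl (a0 (\<rho> j)))" and "B = L0 (Inl (b0 (\<rho> j)))"
      and "E = L0 (Inr (\<rho> j))"
    have "L0 z \<ge> 1" if "z \<in> V0 <+> J0" for z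
      using bij_betwE[OF L0] that by auto
    then have "A \<ge> 1" "B \<ge> 1" "E \<ge> 1"
      using r ends_in[OF r] by (auto simp: A_def B_def E_def)
    moreover have "A + E + B = s"
      using magic r by (simp add: magic_on_def A_def B_def E_def)
    ultimately have "s - 3 = (A - 1) + (E - 1) + (B - 1)"
      by linarith
    then show ?thesis
      using digits[OF j] ends[OF j]
      by (simp add: L_def \<phi>_def d_def A_def B_def E_def algebra_simps)
  qed
  ultimately show ?thesis
    unfolding magic_on_def by blast
qed

section \<open>Even cycles have the valence 5d/2 + 2\<close>

abbreviation cycle_magic :: "nat \<Rightarrow> (nat + nat \<Rightarrow> nat) \<Rightarrow> nat \<Rightarrow> bool" where
  "cycle_magic m \<equiv> magic_on {..<m} {..<m} (\<lambda>i. i) (\<lambda>i. Suc i mod m)"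

lemma cycle_magicI:
  assumes "inj_on F {..<m}" "inj_on E {..<m}"
    and "\<And>i j. i < m \<Longrightarrow> j < m \<Longrightarrow> F i \<noteq> E j"
    and "\<And>i. i < m \<Longrightarrow> F i \<in> {1..2 * m}" "\<And>i. i < m \<Longrightarrow> E i \<in> {1..2 * m}"
    and "\<And>i. i < m \<Longrightarrow> F i + E i + F (Suc i mod m) = s"
  shows "cycle_magic m (case_sum F E) s"
proof -
  have inj: "inj_on (case_sum F E) ({..<m} <+> {..<m})"
  proof (rule inj_onI)
    fix z z' assume z: "z \<in> {..<m} <+> {..<m}" "z' \<in> {..<m} <+> {..<m}"
      and eq: "case_sum F E z = case_sum F E z'"
    have False if "z = Inl i" "z' = Inr j" for i j
      using assms(3)[of i j] z eq that by auto
    moreover have False if "z = Inr i" "z' = Inl j" for i j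
      using assms(3)[of j i] z eq that by auto
    moreover have "z = z'" if "z = Inl i" "z' = Inl j" for i j
      using inj_on_eq_iff[OF assms(1), of i j] z eq that by auto
    moreover have "z = z'" if "z = Inr i" "z' = Inr j" for i j
      using inj_on_eq_iff[OF assms(2), of i j] z eq that by auto
    ultimately show "z = z'"
      by (metis sumE)
  qed
  moreover have sub: "case_sum F E ` ({..<m} <+> {..<m}) \<subseteq> {1..2 * m}"
    using assms(4,5) by (auto simp: image_subset_iff)
  moreover have "card (case_sum F E ` ({..<m} <+> {..<m})) = 2 * m"
    using inj by (simp add: card_image card_Plus)
  ultimately have "case_sum F E ` ({..<m} <+> {..<m}) = {1..2 * m}"
    by (intro card_subset_eq) auto
  then show ?thesis
    using inj assms(6) by (simp add: magic_on_def bij_betw_def mult_2)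
qed

lemma Suc_mod_if: "i < m \<Longrightarrow> Suc i mod m = (if i = m - 1 then 0 else Suc i)"
  by (cases "Suc i = m") auto

text \<open>
  Let \<open>d = 4 * k\<close>. The valence \<open>5 * d / 2 + 2\<close> forces the vertex labels to add up to
  \<open>1 + \<dots> + d + d / 2\<close>. Here they are \<open>1, \<dots>, d\<close> with \<open>d\<close> replaced by \<open>3 * d / 2 = 6 * k\<close>. The edge labels
  decrease, \<open>E i = 8 * k - i\<close>, as long as small and large vertex labels alternate in increasing order.
  This fails at vertex \<open>1\<close>, which bears the exchanged label, at the edge \<open>2 * k\<close>, where the small labels
  change from the even to the odd positions, and at the edge \<open>4 * k - 1\<close>, which closes the cycle.
\<close>

lemma cycle_magic_0_mod_4:
  assumes "k \<ge> 1"
  shows "\<exists>L. cycle_magic (4 * k) L (10 * k + 2)"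
proof -
  define F where "F i = (let j = i div 2 in
    if even i then (if j \<le> k then j + 1 else 2 * k + j)
    else if j = 0 then 6 * k else if j < k then 2 * k + j + 1 else j + 2)" for i
  define E where "E i =
    (if i = 0 then 4 * k + 1 else if i = 1 then 4 * k
     else if i = 2 * k then 8 * k - 1 else if i = 4 * k - 1 then 8 * k else 8 * k - i)" for i
  have F_even: "F (2 * j) = (if j \<le> k then j + 1 else 2 * k + j)" for j
    by (simp add: F_def)
  have F_odd: "F (Suc (2 * j)) = (if j = 0 then 6 * k else if j < k then 2 * k + j + 1 else j + 2)" for j
    by (simp add: F_def)
  have "cycle_magic (4 * k) (case_sum F E) (10 * k + 2)"
  proof (rule cycle_magicI)
    show "inj_on F {..<4 * k}"
    proof (rule inj_onI)
      fix x y assume "x \<in> {..<4 * k}" "y \<in> {..<4 * k}" "F x = F y"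
      moreover obtain u v where "x = 2 * u \<or> x = Suc (2 * u)" "y = 2 * v \<or> y = Suc (2 * v)"
        by (metis evenE oddE Suc_eq_plus1)
      ultimately show "x = y"
        using assms by (elim disjE; simp add: F_even F_odd split: if_splits; presburger)
    qed
    show "inj_on E {..<4 * k}"
    proof (rule inj_onI)
      fix x y assume xy: "x \<in> {..<4 * k}" "y \<in> {..<4 * k}" "E x = E y"
      then have "8 * k - x = 8 * k - y \<longleftrightarrow> x = y" by auto
      then show "x = y"
        using xy assms by (simp add: E_def split: if_splits)
    qed
    have F: "F i \<ge> 1 \<and> (F i < 4 * k \<or> F i = 6 * k)" if "i < 4 * k" for i
      using that assms by (cases "even i") (auto elim!: evenE oddE simp: F_even F_odd split: if_splits)
    have E: "4 * k \<le> E i \<and> E i \<noteq> 6 * k \<and> E i \<le> 2 * (4 * k)" if "i < 4 * k" for i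
      using assms that by (simp add: E_def) presburger
    show "F i \<noteq> E j" if "i < 4 * k" "j < 4 * k" for i j
      using F[OF that(1)] E[OF that(2)] by auto
    show "F i \<in> {1..2 * (4 * k)}" if "i < 4 * k" for i
      using F[OF that] by auto
    show "E i \<in> {1..2 * (4 * k)}" if "i < 4 * k" for i
      using assms E[OF that] by auto
    show "F i + E i + F (Suc i mod (4 * k)) = 10 * k + 2" if "i < 4 * k" for i
    proof (cases "even i")
      case True
      then obtain j where "i = 2 * j" by (elim evenE)
      then show ?thesis
        using assms that by (auto simp: Suc_mod_if F_even F_odd E_def; presburger)
    next
      case False
      then obtain j where j: "i = 2 * j + 1" by (elim oddE)
      then have "Suc i = 2 * (j + 1)" by simp
      then show ?thesis
        using assms that j F_even[of "j + 1"] F_even[of 0]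
        by (auto simp: Suc_mod_if F_odd E_def; presburger)
    qed
  qed
  then show ?thesis by blast
qed

text \<open>
  The same idea for \<open>d = 4 * k + 2\<close>: the vertex labels are \<open>1, \<dots>, d\<close> with \<open>d\<close> replaced by
  \<open>3 * d / 2 = 6 * k + 3\<close>. The small labels now stay at the even positions. The edge labels are
  \<open>E i = 8 * k + 3 - i\<close> except for the two edges at each of the vertices \<open>1\<close>, \<open>2 * k + 1\<close> and
  \<open>4 * k + 1\<close>, whose labels do not follow the pattern of the other odd positions.
\<close>

lemma cycle_magic_2_mod_4:
  assumes "k \<ge> 1"
  shows "\<exists>L. cycle_magic (4 * k + 2) L (10 * k + 7)"
proof -
  define F where "F i = (let j = i div 2 in
    if even i then (if j \<le> k then j + 1 else j + 2)
    else if j = 0 then 6 * k + 3 else if j < k then 2 * k + j + 3 else if j = k then k + 2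
    else if j < 2 * k then 2 * k + j + 2 else 2 * k + 3)" for i
  define E where "E i =
    (if i = 0 then 4 * k + 3 else if i = 1 then 4 * k + 2
     else if i = 2 * k then 8 * k + 4 else if i = 2 * k + 1 then 8 * k + 2
     else if i = 4 * k then 6 * k + 2 else if i = 4 * k + 1 then 8 * k + 3
     else 8 * k + 3 - i)" for i
  have F_even: "F (2 * j) = (if j \<le> k then j + 1 else j + 2)" for j
    by (simp add: F_def)
  have F_odd: "F (Suc (2 * j)) = (if j = 0 then 6 * k + 3 else if j < k then 2 * k + j + 3
    else if j = k then k + 2 else if j < 2 * k then 2 * k + j + 2 else 2 * k + 3)" for j
    by (simp add: F_def)
  have "cycle_magic (4 * k + 2) (case_sum F E) (10 * k + 7)"
  proof (rule cycle_magicI)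
    show "inj_on F {..<4 * k + 2}"
    proof (rule inj_onI)
      fix x y assume "x \<in> {..<4 * k + 2}" "y \<in> {..<4 * k + 2}" "F x = F y"
      moreover obtain u v where "x = 2 * u \<or> x = Suc (2 * u)" "y = 2 * v \<or> y = Suc (2 * v)"
        by (metis evenE oddE Suc_eq_plus1)
      ultimately show "x = y"
        using assms by (elim disjE; simp add: F_even F_odd split: if_splits; presburger)
    qed
    show "inj_on E {..<4 * k + 2}"
    proof (rule inj_onI)
      fix x y assume xy: "x \<in> {..<4 * k + 2}" "y \<in> {..<4 * k + 2}" "E x = E y"
      then have "8 * k + 3 - x = 8 * k + 3 - y \<longleftrightarrow> x = y" by auto
      then show "x = y"
        using xy assms by (simp add: E_def split: if_splits)
    qed
    have F: "F i \<ge> 1 \<and> (F i < 4 * k + 2 \<or> F i = 6 * k + 3)" if "i < 4 * k + 2" for i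
      using that assms by (cases "even i") (auto elim!: evenE oddE simp: F_even F_odd split: if_splits)
    have E: "4 * k + 2 \<le> E i \<and> E i \<noteq> 6 * k + 3 \<and> E i \<le> 2 * (4 * k + 2)" if "i < 4 * k + 2" for i
      using assms that by (simp add: E_def) presburger
    show "F i \<noteq> E j" if "i < 4 * k + 2" "j < 4 * k + 2" for i j
      using F[OF that(1)] E[OF that(2)] by auto
    show "F i \<in> {1..2 * (4 * k + 2)}" if "i < 4 * k + 2" for i
      using F[OF that] by auto
    show "E i \<in> {1..2 * (4 * k + 2)}" if "i < 4 * k + 2" for i
      using assms E[OF that] by auto
    show "F i + E i + F (Suc i mod (4 * k + 2)) = 10 * k + 7" if "i < 4 * k + 2" for i
    proof (cases "even i")
      case True
      then obtain j where "i = 2 * j" by (elim evenE)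
      then show ?thesis
        using assms that by (auto simp: Suc_mod_if F_even F_odd E_def; presburger)
    next
      case False
      then obtain j where j: "i = 2 * j + 1" by (elim oddE)
      then have "Suc i = 2 * (j + 1)" by simp
      then show ?thesis
        using assms that j F_even[of "j + 1"] F_even[of 0]
        by (auto simp: Suc_mod_if F_odd E_def; presburger)
    qed
  qed
  then show ?thesis by blast
qed

lemma cycle_magic_even:
  assumes "even d" "d \<ge> 4"
  shows "\<exists>L. cycle_magic d L (5 * (d div 2) + 2)"
proof (cases "4 dvd d")
  case True
  then obtain k where "d = 4 * k" by blast
  then show ?thesis using cycle_magic_0_mod_4[of k] assms by simp
next
  case False
  then have "d = 4 * (d div 4) + 2" using assms(1) by presburger
  then obtain k where k: "d = 4 * k + 2" by blast
  then have "k \<ge> 1" using assms by simp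
  moreover have "5 * (d div 2) + 2 = 10 * k + 7" using k by simp
  ultimately show ?thesis using cycle_magic_2_mod_4[of k] by (simp only: k)
qed

section \<open>From a cycle to an odd multiple of its order\<close>

lemma bij_betw_shifted_div_mod:
  assumes "d > 0"
  shows "bij_betw (\<lambda>t. (t mod d, (t div d + e (t mod d)) mod p)) {..<d * p} ({..<d} \<times> {..<p :: nat})"
proof (rule bij_betw_imageI)
  let ?f = "\<lambda>t. (t mod d, (t div d + e (t mod d)) mod p)"
  show inj: "inj_on ?f {..<d * p}"
  proof (rule inj_onI)
    fix t t' assume t: "t \<in> {..<d * p}" "t' \<in> {..<d * p}" and eq: "?f t = ?f t'"
    have lt: "t div d < p" "t' div d < p"
      using t by (simp_all add: less_mult_imp_div_less mult.commute)
    have "[t div d + e (t mod d) = t' div d + e (t mod d)] (mod p)"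
      using eq by (auto simp: cong_def)
    then have "t div d = t' div d"
      using lt by (simp add: cong_add_rcancel_nat cong_less_modulus_unique_nat)
    then show "t = t'"
      using eq by (metis div_mult_mod_eq prod.inject)
  qed
  have "?f ` {..<d * p} \<subseteq> {..<d} \<times> {..<p}"
    using assms by (cases "p = 0") auto
  moreover have "card (?f ` {..<d * p}) = card ({..<d} \<times> {..<p})"
    using inj by (simp add: card_image)
  ultimately show "?f ` {..<d * p} = {..<d} \<times> {..<p}"
    by (intro card_subset_eq) auto
qed

text \<open>
  For \<open>p = 2 * h - 1\<close>, the sums of \<open>l\<close> and \<open>(l + h) mod p\<close> are the \<open>p\<close> consecutive numbers
  \<open>h - 1, \<dots>, 3 * h - 3\<close>: those with \<open>l < h - 1\<close> are \<open>h, h + 2, \<dots>, 3 * h - 4\<close>, and the others, which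
  wrap around, fill the gaps and the two ends. Hence their complements to \<open>3 * h - 3\<close> are
  exactly the digits.
\<close>

lemma bij_betw_complement_of_shift_sums:
  fixes h :: nat
  assumes "h \<ge> 1"
  shows "bij_betw (\<lambda>l. 3 * h - 3 - (l + (l + h) mod (2 * h - 1))) {..<2 * h - 1} {..<2 * h - 1}"
proof -
  let ?f = "\<lambda>l. 3 * h - 3 - (l + (l + h) mod (2 * h - 1))"
  have eq: "?f l = (if l < h - 1 then 2 * (h - 2 - l) + 1 else 2 * (2 * h - 2 - l))"
    if "l < 2 * h - 1" for l
  proof (cases "l < h - 1")
    case True
    then show ?thesis by simp
  next
    case False
    then have "(l + h) mod (2 * h - 1) = l + h - (2 * h - 1)"
      using that assms by (subst le_mod_geq) auto
    then show ?thesis using that False by simp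
  qed
  have inj: "inj_on ?f {..<2 * h - 1}"
  proof (rule inj_onI)
    fix l l' assume l: "l \<in> {..<2 * h - 1}" "l' \<in> {..<2 * h - 1}" "?f l = ?f l'"
    have parity: "2 * u + 1 \<noteq> 2 * v" for u v :: nat by presburger
    show "l = l'"
    proof (cases "l < h - 1 \<longleftrightarrow> l' < h - 1")
      case True
      then have "h - 2 - l = h - 2 - l' \<and> l < h - 1 \<and> l' < h - 1
          \<or> 2 * h - 2 - l = 2 * h - 2 - l'"
        using l eq[of l] eq[of l'] by (cases "l < h - 1") simp_all
      then show ?thesis
        using l(1,2) by auto
    next
      case False
      then show ?thesis
        using l eq[of l] eq[of l'] parity parity[symmetric]
        by (cases "l < h - 1") (simp_all del: One_nat_def add_2_eq_Suc' Suc_eq_plus1_left)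
    qed
  qed
  moreover have "?f ` {..<2 * h - 1} \<subseteq> {..<2 * h - 1}"
  proof (intro image_subsetI)
    fix l assume "l \<in> {..<2 * h - 1}"
    then show "?f l \<in> {..<2 * h - 1}"
      using eq[of l] by (simp split: if_splits) 
  qed
  ultimately show ?thesis
    by (simp add: bij_betw_def endo_inj_surj)
qed

text \<open>
  The long cycle runs \<open>p\<close> times around the short one. Neighbouring digits must differ by
  \<open>\<plusminus>h\<close> modulo \<open>p = 2 * h - 1\<close>, so that each edge can be completed to the digit sum \<open>3 * h - 3\<close>. Within
  one round the digit goes up by \<open>h\<close> twice and then alternately down and up; as \<open>d\<close> is even, the
  net change is \<open>2 * h\<close>, that is, \<open>1\<close> modulo \<open>p\<close>. So the walk passes through all digits above each
  vertex and closes up after exactly \<open>p\<close> rounds.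
\<close>

lemma cycle_magic_mult_odd:
  assumes magic: "cycle_magic d L s" and d: "even d" "d > 0" and h: "h \<ge> 1"
  shows "\<exists>L. cycle_magic (d * (2 * h - 1)) L ((2 * h - 1) * (s - 3) + 3 * h)"
proof -
  define p where "p = 2 * h - 1"
  define y where "y t = (t div d + (if t mod d = 0 then 0 else if odd (t mod d) then h else 1)) mod p" for t
  \<comment> \<open>the lower end of the step \<open>l \<mapsto> l + h\<close> that the edge \<open>t\<close> makes, in either direction\<close>
  define z where "z t = (t div d + (if t mod d = 0 then 0 else h)) mod p" for t
  define \<tau> where "\<tau> l = 3 * h - 3 - (l + (l + h) mod p)" for l
  have p: "p > 0" using h by (simp add: p_def)
  have half: "(q + h + h) mod p = (q + 1) mod p" for q
  proof -
    have "q + h + h = q + 1 + p" using h by (simp add: p_def)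
    then show ?thesis by (metis mod_add_self2)
  qed
  have pairs: "y t = z t \<and> y (Suc t) = (z t + h) mod p \<or> y t = (z t + h) mod p \<and> y (Suc t) = z t" for t
  proof -
    have d2: "d \<ge> 2" using d by (auto elim: evenE)
    show ?thesis
    proof (cases "Suc (t mod d) = d")
      case True
      then have "odd (t mod d)" using d(1) by (metis even_Suc)
      moreover have "Suc t mod d = 0" "Suc t div d = Suc (t div d)"
        using True by (simp_all add: mod_Suc div_Suc)
      ultimately show ?thesis
        using half[of "t div d"] by (auto simp: y_def z_def mod_add_left_eq)
    next
      case False
      then have "Suc t mod d = Suc (t mod d)" "Suc t div d = t div d"
        by (simp_all add: mod_Suc div_Suc)
      then show ?thesis
        using half[of "t div d"] d2 by (auto simp: y_def z_def mod_add_left_eq)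
    qed
  qed
  have wrap: "y (Suc t mod (d * p)) = y (Suc t)" if "t < d * p" for t
    using that d p by (cases "Suc t = d * p") (auto simp: y_def)
  have \<tau>: "l + \<tau> l + (l + h) mod p = 3 * h - 3" if "l < p" for l
  proof -
    have "l + (l + h) mod p \<le> 3 * h - 3"
    proof (cases "l + h < p")
      case True
      then show ?thesis by (simp add: p_def)
    next
      case False
      then have "(l + h) mod p = l + h - p"
        using that h by (subst le_mod_geq) (auto simp: p_def)
      then show ?thesis using that False by (simp add: p_def)
    qed
    then show ?thesis by (simp add: \<tau>_def)
  qed
  have "\<exists>L. cycle_magic (d * p) L (p * (s - 3) + (3 * h - 3) + 3)"
  proof (rule magic_on_lift[OF magic])
    show "bij_betw (\<lambda>t. (t mod d, y t)) {..<d * p} ({..<d} \<times> {..<p})"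
      unfolding y_def
      by (rule bij_betw_shifted_div_mod[OF d(2), where e = "\<lambda>r. if r = 0 then 0 else if odd r then h else 1"])
    have "bij_betw (\<lambda>t. (t mod d, z t)) {..<d * p} ({..<d} \<times> {..<p})"
      unfolding z_def
      by (rule bij_betw_shifted_div_mod[OF d(2), where e = "\<lambda>r. if r = 0 then 0 else h"])
    moreover have "bij_betw (map_prod id \<tau>) ({..<d} \<times> {..<p}) ({..<d} \<times> {..<p})"
      using bij_betw_complement_of_shift_sums[OF h]
      by (intro bij_betw_map_prod) (auto simp: p_def \<tau>_def[abs_def])
    ultimately have "bij_betw (map_prod id \<tau> \<circ> (\<lambda>t. (t mod d, z t))) {..<d * p} ({..<d} \<times> {..<p})"
      by (rule bij_betw_trans)
    then show "bij_betw (\<lambda>t. (t mod d, \<tau> (z t))) {..<d * p} ({..<d} \<times> {..<p})"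
      by (simp add: o_def)
    show "t mod d = t mod d \<and> Suc t mod (d * p) mod d = Suc (t mod d) mod d"
      if "t \<in> {..<d * p}" for t
      by (simp add: mod_mod_cancel mod_Suc_eq)
    show "j \<in> {..<d} \<and> Suc j mod d \<in> {..<d}" if "j \<in> {..<d}" for j
      using that by auto
    show "y t + \<tau> (z t) + y (Suc t mod (d * p)) = 3 * h - 3" if "t \<in> {..<d * p}" for t
    proof -
      have "z t < p" using p by (simp add: z_def)
      from \<tau>[OF this] show ?thesis
        using pairs[of t] wrap[of t] that by auto
    qed
  qed
  moreover have "p * (s - 3) + (3 * h - 3) + 3 = p * (s - 3) + 3 * h"
    using h by simp
  ultimately show ?thesis
    by (simp only: p_def)
qed

section \<open>From a cycle to its corona\<close>

lemma Suc_mod_eq_iff: "v < m \<Longrightarrow> w < m \<Longrightarrow> Suc v mod m = Suc w mod m \<longleftrightarrow> v = w"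
  by (cases "Suc v = m"; cases "Suc w = m") auto

text \<open>
  Above each edge of \<open>C\<^sub>m\<close> from \<open>v\<close> to its successor lie the \<open>n + 1\<close> edges from \<open>v\<close> to a vertex of the
  corona above the successor: these are the cycle edge and the \<open>n\<close> pendant edges at \<open>v\<close>, once each
  pendant vertex is put above the successor of the vertex to which it is attached. The cycle
  vertices have digit \<open>r\<close>, the pendant vertices the remaining digits in order, and the edge that
  ends in a vertex with digit \<open>l\<close> has digit \<open>n - l\<close>.
\<close>

lemma magic_sums_corona_if_cycle_magic:
  assumes magic: "cycle_magic m L s" and m: "m \<ge> 3" and r: "r \<le> n"
  shows "(n + 1) * (s - 3) + r + n + 3 \<in> magic_sums (corona (cycle_graph m) (edgeless_graph n))"
proof -
  let ?G = "corona (cycle_graph m) (edgeless_graph n)"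
  define J where "J = {..<m} \<times> {..<n + 1}"
  define a :: "nat \<times> nat \<Rightarrow> nat + nat \<times> nat" where "a = (\<lambda>(v, l). Inl v)"
  define b :: "nat \<times> nat \<Rightarrow> nat + nat \<times> nat" where
    "b = (\<lambda>(v, l). if l = r then Inl (Suc v mod m) else Inr (v, if l < r then l else l - 1))"
  define \<pi> :: "nat + nat \<times> nat \<Rightarrow> nat" where "\<pi> = case_sum id (\<lambda>(v, w). Suc v mod m)"
  define c :: "nat + nat \<times> nat \<Rightarrow> nat" where
    "c = case_sum (\<lambda>v. r) (\<lambda>(v, w). if w < r then w else w + 1)"
  have verts: "verts ?G = {..<m} <+> {..<m} \<times> {..<n}"
    by (simp add: corona_def cycle_graph_def edgeless_graph_def Plus_def)
  have V: "bij_betw (\<lambda>x. (\<pi> x, c x)) (verts ?G) ({..<m} \<times> {..<n + 1})"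
  proof (rule bij_betw_imageI)
    show inj: "inj_on (\<lambda>x. (\<pi> x, c x)) (verts ?G)"
    proof (rule inj_onI)
      fix x x' assume "x \<in> verts ?G" "x' \<in> verts ?G" "(\<pi> x, c x) = (\<pi> x', c x')"
      then show "x = x'"
        unfolding verts
        by (elim PlusE) (auto simp: \<pi>_def c_def Suc_mod_eq_iff split: if_splits)
    qed
    have "(\<lambda>x. (\<pi> x, c x)) ` verts ?G \<subseteq> {..<m} \<times> {..<n + 1}"
      using r m unfolding verts by (auto simp: \<pi>_def c_def elim!: PlusE)
    moreover have "card ((\<lambda>x. (\<pi> x, c x)) ` verts ?G) = card ({..<m} \<times> {..<n + 1})"
      using inj by (simp add: card_image) (simp add: verts card_Plus)
    ultimately show "(\<lambda>x. (\<pi> x, c x)) ` verts ?G = {..<m} \<times> {..<n + 1}"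
      by (intro card_subset_eq) auto
  qed
  have J: "bij_betw (\<lambda>j. (fst j, n - snd j)) J ({..<m} \<times> {..<n + 1})"
    unfolding J_def
    by (rule bij_betw_byWitness[where f' = "\<lambda>(v, l). (v, n - l)"]) auto
  have "\<exists>L. magic_on (verts ?G) J a b L ((n + 1) * (s - 3) + (r + n) + 3)"
  proof (rule magic_on_lift[OF magic V J])
    show "\<pi> (a j) = fst j \<and> \<pi> (b j) = Suc (fst j) mod m" if "j \<in> J" for j
      by (simp add: \<pi>_def a_def b_def split: prod.split)
    show "j \<in> {..<m} \<and> Suc j mod m \<in> {..<m}" if "j \<in> {..<m}" for j
      using that by auto
    show "c (a j) + (n - snd j) + c (b j) = r + n" if "j \<in> J" for j
      using that by (auto simp: c_def a_def b_def J_def)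
  qed
  then obtain L' where L': "magic_on (verts ?G) J a b L' ((n + 1) * (s - 3) + r + n + 3)"
    by (auto simp: add.assoc)
  have "bij_betw (\<lambda>j. {a j, b j}) J (edges ?G)"
  proof (rule bij_betw_imageI)
    have no_2cycle: "Suc w mod m \<noteq> v" if "Suc v mod m = w" "v < m" for v w
      using that m by (cases "Suc v = m"; cases "Suc w = m") auto
    show "inj_on (\<lambda>j. {a j, b j}) J"
    proof (rule inj_onI)
      fix j j' assume j: "j \<in> J" "j' \<in> J" "{a j, b j} = {a j', b j'}"
      obtain v l v' l' where vl: "j = (v, l)" "j' = (v', l')" by fastforce
      consider "v = v'" "b j = b j'" | "b j' = Inl v" "b j = Inl v'"
        using j(3) by (auto simp: a_def vl doubleton_eq_iff)
      then show "j = j'"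
      proof cases
        case 1
        then show ?thesis by (auto simp: b_def vl split: if_splits)
      next
        case 2
        then have "Suc v mod m = v'" "Suc v' mod m = v"
          by (auto simp: b_def vl split: if_splits)
        then show ?thesis
          using no_2cycle[of v v'] j(1) by (auto simp: J_def vl)
      qed
    qed
    have edges: "edges ?G = {{Inl v, Inl (Suc v mod m)} | v. v < m}
        \<union> {{Inl v, Inr (v, w)} | v w. v < m \<and> w < n}"
    proof -
      have "{(Inl :: nat \<Rightarrow> nat + nat \<times> nat) ` e | e. e \<in> {{i, Suc i mod m} | i. i < m}}
          = {{Inl v, Inl (Suc v mod m)} | v. v < m}" (is "?A = ?B")
      proof (intro equalityI subsetI)
        fix x assume "x \<in> ?A"
        then obtain i where "i < m" "x = Inl ` {i, Suc i mod m}" by blast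
        then show "x \<in> ?B" by auto
      next
        fix x assume "x \<in> ?B"
        then obtain v where v: "v < m" "x = {Inl v, Inl (Suc v mod m)}" by blast
        then have "x = Inl ` {v, Suc v mod m}" by simp
        then show "x \<in> ?A" using v(1) by blast
      qed
      then show ?thesis
        by (simp add: corona_def cycle_graph_def edgeless_graph_def)
    qed
    show "(\<lambda>j. {a j, b j}) ` J = edges ?G"
    proof (intro equalityI subsetI)
      fix e assume "e \<in> (\<lambda>j. {a j, b j}) ` J"
      then obtain v l where v: "v < m" and l: "l < n + 1" and e: "e = {a (v, l), b (v, l)}"
        by (auto simp: J_def)
      show "e \<in> edges ?G"
      proof (cases "l = r")
        case True
        then have "e = {Inl v, Inl (Suc v mod m)}" using e by (simp add: a_def b_def)
        then show ?thesis
          unfolding edges using v by (intro UnI1 CollectI exI[of _ v]) simp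
      next
        case False
        define w where "w = (if l < r then l else l - 1)"
        have "w < n" using False r l by (auto simp: w_def)
        moreover have "e = {Inl v, Inr (v, w)}" using e False by (simp add: a_def b_def w_def)
        ultimately show ?thesis
          unfolding edges using v by (intro UnI2 CollectI exI[of _ v] exI[of _ w]) simp
      qed
    next
      fix e assume "e \<in> edges ?G"
      then show "e \<in> (\<lambda>j. {a j, b j}) ` J"
        unfolding edges
      proof (elim UnE CollectE exE conjE)
        fix v assume "e = {Inl v, Inl (Suc v mod m)}" "v < m"
        then have "e = {a (v, r), b (v, r)}" "(v, r) \<in> J"
          using r by (simp_all add: a_def b_def J_def)
        then show ?thesis by (rule image_eqI)
      next
        fix v w assume e: "e = {Inl v, Inr (v, w)}" "v < m" "w < n"
        let ?l = "if w < r then w else w + 1"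
        have "e = {a (v, ?l), b (v, ?l)}" "(v, ?l) \<in> J"
          using e by (simp_all add: a_def b_def J_def)
        then show ?thesis by (rule image_eqI)
      qed
    qed
  qed
  then show ?thesis
    by (rule magic_sums_if_magic_on[OF L'])
qed

section \<open>Counting valences by odd divisors\<close>

text \<open>
  The base cycle has order \<open>d = m div p\<close>. Its valence \<open>5 * d / 2 + 2\<close> is lifted to
  \<open>p * (5 * d / 2 - 1) + 3 * (p + 1) / 2\<close>, and \<open>p * d = m\<close>.
\<close>

lemma cycle_magic_odd_divisor:
  assumes m: "even m" and p: "odd p" "p dvd m" "m div p \<ge> 4"
  shows "\<exists>L. cycle_magic m L (5 * (m div 2) + (p + 3) div 2)"
proof -
  obtain u where u: "p = 2 * u + 1" using p(1) by (elim oddE)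
  define h where "h = u + 1"
  have h: "2 * h - 1 = p" "h \<ge> 1" by (simp_all add: h_def u)
  have md: "m = (m div p) * p" using p(2) by simp
  have "even (m div p)" using m p(1) md by (metis even_mult_iff)
  then obtain e where e: "m div p = 2 * e" by (elim evenE)
  have "e \<ge> 2" using e p(3) by simp
  obtain L where "cycle_magic (m div p) L (5 * e + 2)"
    using cycle_magic_even[of "m div p"] e p(3) by auto
  from cycle_magic_mult_odd[OF this _ _ h(2)]
  have "\<exists>L. cycle_magic m L (p * (5 * e + 2 - 3) + 3 * h)"
    unfolding h(1) md[symmetric] using e p(3) by simp
  moreover have "p * (5 * e + 2 - 3) + 3 * h = 5 * (m div 2) + (p + 3) div 2"
  proof -
    have "m = 2 * (e * p)" using md e by simp
    then have "m div 2 = e * p" by simp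
    moreover obtain e' where "e = e' + 1"
      using \<open>e \<ge> 2\<close> by (cases e) auto
    ultimately show ?thesis by (simp add: h_def u algebra_simps)
  qed
  ultimately show ?thesis by simp
qed

lemma card_magic_sums_corona_ge:
  assumes m: "m \<ge> 3" "even m"
  shows "card {p. odd p \<and> p dvd m \<and> m div p \<ge> 4} * (n + 1)
    \<le> card (magic_sums (corona (cycle_graph m) (edgeless_graph n)))"
proof -
  let ?P = "{p. odd p \<and> p dvd m \<and> m div p \<ge> 4}"
  let ?G = "corona (cycle_graph m) (edgeless_graph n)"
  define g where "g = (\<lambda>(p, r). (n + 1) * (5 * (m div 2) + (p + 3) div 2 - 3) + r + n + 3)"
  have "inj_on g (?P \<times> {..<n + 1})"
  proof (rule inj_onI)
    fix x x' assume x: "x \<in> ?P \<times> {..<n + 1}" "x' \<in> ?P \<times> {..<n + 1}" "g x = g x'"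
    obtain p r p' r' where pr: "x = (p, r)" "x' = (p', r')" by fastforce
    let ?s = "\<lambda>p. 5 * (m div 2) + (p + 3) div 2 - 3"
    have eq: "r + (n + 1) * ?s p = r' + (n + 1) * ?s p'" and r: "r < n + 1" "r' < n + 1"
      using x by (simp_all add: g_def pr)
    have digits: "(c + N * u) div N = u \<and> (c + N * u) mod N = c" if "c < N" for c N u :: nat
      using that by simp
    have "?s p = ?s p'" "r = r'"
      using digits[OF r(1), of "?s p"] digits[OF r(2), of "?s p'"] eq by metis+
    moreover obtain u v where "p = 2 * u + 1" "p' = 2 * v + 1"
      using x by (auto simp: pr elim!: oddE)
    moreover have "m div 2 \<ge> 1" using m by simp
    ultimately show "x = x'"
      by (simp add: pr)
  qed
  moreover have "g ` (?P \<times> {..<n + 1}) \<subseteq> magic_sums ?G"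
  proof (intro image_subsetI)
    fix x assume x: "x \<in> ?P \<times> {..<n + 1}"
    obtain p r where pr: "x = (p, r)" by fastforce
    obtain L where "cycle_magic m L (5 * (m div 2) + (p + 3) div 2)"
      using cycle_magic_odd_divisor[of m p] m x pr by auto
    from magic_sums_corona_if_cycle_magic[OF this m(1), of r n] show "g x \<in> magic_sums ?G"
      using x by (simp add: g_def pr)
  qed
  moreover have "finite (magic_sums ?G)"
  proof (rule finite_magic_sums)
    show "simple_graph ?G"
      using m by (intro simple_graph_corona simple_graph_cycle_graph simple_graph_edgeless_graph)
    have "{0, Suc 0 mod m} \<in> edges (cycle_graph m)"
      unfolding cycle_graph_def ugraph.simps
      by (intro CollectI exI[of _ 0]) (use m in simp)
    then show "edges ?G \<noteq> {}"
      unfolding corona_def ugraph.simps by blast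
  qed
  ultimately have "card (?P \<times> {..<n + 1}) \<le> card (magic_sums ?G)"
    by (rule card_inj_on_le)
  then show ?thesis by (simp add: card_cartesian_product)
qed

text \<open>
  Multiplication by \<open>b\<close> keeps all divisors and adds at least the new number itself.
\<close>

lemma card_divisors_mult_power_ge:
  fixes x b :: nat
  assumes "x > 0" "b \<ge> 2"
  shows "card {d. d dvd x * b ^ k} \<ge> card {d. d dvd x} + k"
proof (induction k)
  case (Suc k)
  let ?y = "x * b ^ k"
  have y: "?y > 0" using assms by simp
  have "insert (?y * b) {d. d dvd ?y} \<subseteq> {d. d dvd ?y * b}"
    by (auto intro: dvd_mult2)
  moreover have "?y * b \<notin> {d. d dvd ?y}"
    using y assms by (auto dest: dvd_imp_le)
  moreover have "finite {d. d dvd ?y * b}"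
    using y assms by (intro finite_divisors_nat) simp
  ultimately have "Suc (card {d. d dvd ?y}) \<le> card {d. d dvd ?y * b}"
    using y by (metis card_insert_disjoint card_mono finite_divisors_nat)
  then show ?case
    using Suc by (simp add: mult_ac)
qed simp

lemma card_divisors_prod_ge:
  fixes x e :: "'i \<Rightarrow> nat"
  assumes "finite I" "\<And>i. i \<in> I \<Longrightarrow> x i \<ge> 2"
  shows "card {d. d dvd (\<Prod>i\<in>I. x i ^ e i)} \<ge> 1 + (\<Sum>i\<in>I. e i)"
  using assms
proof (induction I rule: finite_induct)
  case (insert i I)
  have "(\<Prod>i\<in>I. x i ^ e i) > 0"
    using insert.prems by (intro prod_pos) (force simp: zero_less_power)
  from card_divisors_mult_power_ge[OF this, of "x i" "e i"] show ?case
    using insert by (simp add: mult.commute)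
qed simp

theorem theorem4p4:
  fixes m n k \<alpha> :: nat and p a :: "nat \<Rightarrow> nat"
  assumes "m \<ge> 3" and "even m" and "n > 0"
    and "m = 2 ^ \<alpha> * (\<Prod>i=1..k. p i ^ a i)"
    and "inj_on p {1..k}"
    and "\<And>i. i \<in> {1..k} \<Longrightarrow> prime (p i) \<and> odd (p i) \<and> a i \<ge> 1"
  shows "card (magic_sums (corona (cycle_graph m) (edgeless_graph n))) \<ge> (\<Sum>i=1..k. a i) * (n + 1)
    \<and> (\<alpha> \<ge> 2 \<longrightarrow>
       card (magic_sums (corona (cycle_graph m) (edgeless_graph n))) \<ge> (1 + (\<Sum>i=1..k. a i)) * (n + 1))"
proof -
  define q where "q = (\<Prod>i=1..k. p i ^ a i)"
  let ?P = "{p. odd p \<and> p dvd m \<and> m div p \<ge> 4}"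
  have m: "m = 2 ^ \<alpha> * q"
    using assms(4) by (simp add: q_def)
  have q: "odd q"
    using assms(6) by (simp add: q_def even_prod_iff)
  then have "q > 0" by (rule odd_pos)
  have \<alpha>: "\<alpha> \<ge> 1"
    using assms(2) q by (cases \<alpha>) (simp_all add: m)
  have divisors: "1 + (\<Sum>i=1..k. a i) \<le> card {d. d dvd q}"
    unfolding q_def using assms(6) by (intro card_divisors_prod_ge) (auto simp: prime_ge_2_nat)
  have finP: "finite ?P"
    by (rule finite_subset[OF _ finite_divisors_nat[of m]]) (use assms(1) in auto)
  have fin_q: "finite {d. d dvd q}"
    using \<open>q > 0\<close> by (rule finite_divisors_nat)
  have quotient: "odd d \<and> d dvd m \<and> m div d = 2 ^ \<alpha> * (q div d)" if "d dvd q" for d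
    using that q dvd_trans[of 2 d q] by (auto simp: m div_mult_swap)
  note bound = card_magic_sums_corona_ge[OF assms(1,2), of n]
  \<comment> \<open>For a proper divisor \<open>d\<close>, both \<open>q div d\<close> and \<open>2 ^ \<alpha>\<close> are at least \<open>2\<close>.\<close>
  have "{d. d dvd q} - {q} \<subseteq> ?P"
  proof
    fix d assume d: "d \<in> {d. d dvd q} - {q}"
    then obtain e where e: "q = d * e" by blast
    have "d \<noteq> 0" "e \<noteq> 0" "e \<noteq> 1"
      using d \<open>q > 0\<close> e by auto
    then have "d > 0" "e \<ge> 2" by auto
    then have "q div d \<ge> 2" by (simp add: e)
    moreover have "(2::nat) ^ \<alpha> \<ge> 2 ^ 1" using \<alpha> by (intro power_increasing) auto
    ultimately have "2 * 2 \<le> 2 ^ \<alpha> * (q div d)" by (intro mult_le_mono) auto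
    then show "d \<in> ?P" using quotient[of d] d by simp
  qed
  then have "card ({d. d dvd q} - {q}) \<le> card ?P"
    using finP card_mono by blast
  then have "(\<Sum>i=1..k. a i) \<le> card ?P"
    using divisors fin_q by (simp add: card_Diff_singleton)
  then have "(\<Sum>i=1..k. a i) * (n + 1) \<le> card ?P * (n + 1)"
    by (rule mult_le_mono1)
  note first = this[THEN le_trans, OF bound]
  have second: "(1 + (\<Sum>i=1..k. a i)) * (n + 1)
      \<le> card (magic_sums (corona (cycle_graph m) (edgeless_graph n)))" if "\<alpha> \<ge> 2"
  proof -
    have "{d. d dvd q} \<subseteq> ?P"
    proof
      fix d assume d: "d \<in> {d. d dvd q}"
      then have "q div d \<ge> 1"
        using \<open>q > 0\<close> by (auto simp: Suc_le_eq div_greater_zero_iff dvd_imp_le dvd_pos_nat)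
      moreover have "(2::nat) ^ \<alpha> \<ge> 2 ^ 2" using that by (intro power_increasing) auto
      ultimately have "4 * 1 \<le> 2 ^ \<alpha> * (q div d)" by (intro mult_le_mono) auto
      then show "d \<in> ?P" using quotient[of d] d by simp
    qed
    then have "card {d. d dvd q} \<le> card ?P"
      using finP card_mono by blast
    then have "(1 + (\<Sum>i=1..k. a i)) * (n + 1) \<le> card ?P * (n + 1)"
      using divisors by (intro mult_le_mono1) simp
    then show ?thesis using bound by (rule le_trans)
  qed
  show ?thesis using first second by blast
qed

end
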